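(* Let $B$ be the open unit ball of $\mathbb{C}^n$ endowed with any norm. The mapping $\Phi:\mathcal{H}L_0(B)\to\mathcal{H}^\infty_s(B,\mathbb{C}^n)$ given by $\Phi(g)=dg$ is an isometric isomorphism.
   Context: Write $X=\mathbb{C}^n$ with the given norm, so $B=B_X$. $\mathcal{H}L_0(B)$ is the Banach space of all bounded holomorphic functions $g:B\to\mathbb{C}$ which are Lipschitz and satisfy $g(0)=0$, with norm $L(g)=\sup\{|g(x)-g(y)|/\|x-y\| : x\neq y\in B\}$. The differential is identified with the $\mathbb{C}^n$-valued map $dg(z)=\big(\frac{\partial g}{\partial z_1}(z),\dots,\frac{\partial g}{\partial z_n}(z)\big)$, where $\partial/\partial z_k$ are complex partial derivatives. In the target, $\mathbb{C}^n$ is identified with the dual $X^*$ (a vector $w$ corresponds to the functional $z\mapsto\sum_j w_jz_j$) and carries the dual norm. $\mathcal{H}^\infty(B,\mathbb{C}^n)$ is the Banach space of bounded holomorphic maps $F:B\to\mathbb{C}^n$ with norm $\|F\|=\sup_{z\in B}\|F(z)\|_{X^*}$, and $$\mathcal{H}^\infty_s(B,\mathbb{C}^n)=\Big\{F=(F_1,\dots,F_n)\in\mathcal{H}^\infty(B,\mathbb{C}^n) : \frac{\partial F_j}{\partial z_k}(z)=\frac{\partial F_k}{\partial z_j}(z)\ \ \forall z\in B,\ \forall j,k=1,\dots,n\Big\}$$ with the norm inherited from $\mathcal{H}^\infty(B,\mathbb{C}^n)$. An isometric isomorphism is a surjective linear isometry. *)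

theory Defs
  imports "HOL-Complex_Analysis.Complex_Analysis" "HOL-Library.Function_Algebras"
begin

text \<open>
  Normed complex vector spaces are given by a scalar multiplication, a carrier and a norm, because
  both the norm on \<open>\<complex>\<^sup>n\<close> and the function spaces depending on it are variable.
\<close>

definition cnormed_space ::
  "(complex \<Rightarrow> 'v::ab_group_add \<Rightarrow> 'v) \<Rightarrow> 'v set \<Rightarrow> ('v \<Rightarrow> real) \<Rightarrow> bool" where
  "cnormed_space sc V N \<longleftrightarrow>
     module sc \<and> module.subspace sc V \<and>
     (\<forall>x\<in>V. 0 \<le> N x) \<and>
     (\<forall>x\<in>V. N x = 0 \<longleftrightarrow> x = 0) \<and>
     (\<forall>c. \<forall>x\<in>V. N (sc c x) = cmod c * N x) \<and>
     (\<forall>x\<in>V. \<forall>y\<in>V. N (x + y) \<le> N x + N y)"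

definition isometric_isomorphism ::
  "(complex \<Rightarrow> 'v::ab_group_add \<Rightarrow> 'v) \<Rightarrow> 'v set \<Rightarrow> ('v \<Rightarrow> real) \<Rightarrow>
   (complex \<Rightarrow> 'w::ab_group_add \<Rightarrow> 'w) \<Rightarrow> 'w set \<Rightarrow> ('w \<Rightarrow> real) \<Rightarrow> ('v \<Rightarrow> 'w) \<Rightarrow> bool" where
  "isometric_isomorphism sV V NV sW W NW T \<longleftrightarrow>
     cnormed_space sV V NV \<and> cnormed_space sW W NW \<and>
     (\<forall>x\<in>V. \<forall>y\<in>V. T (x + y) = T x + T y) \<and>
     (\<forall>c. \<forall>x\<in>V. T (sV c x) = sW c (T x)) \<and>
     (\<forall>x\<in>V. NW (T x) = NV x) \<and>
     T ` V = W"

definition fun_scale :: "('c \<Rightarrow> 'b \<Rightarrow> 'b) \<Rightarrow> 'c \<Rightarrow> ('a \<Rightarrow> 'b) \<Rightarrow> ('a \<Rightarrow> 'b)" where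
  "fun_scale sc c f = (\<lambda>z. sc c (f z))"

definition unit_ball :: "(complex ^ 'n \<Rightarrow> real) \<Rightarrow> (complex ^ 'n) set" where
  "unit_ball N = {z. N z < 1}"

text \<open>
  The bilinear pairing below (no conjugation) identifies \<open>w\<close> with a functional on \<open>\<complex>\<^sup>n\<close>.
\<close>

definition dual_norm :: "(complex ^ 'n \<Rightarrow> real) \<Rightarrow> complex ^ 'n \<Rightarrow> real" where
  "dual_norm N w = (SUP z\<in>{z. N z \<le> 1}. cmod (\<Sum>j\<in>UNIV. w $ j * z $ j))"

text \<open>
  Holomorphy in several variables is Frechet differentiability with complex-linear derivative.
  The derivative refers to the Euclidean norm of \<^typ>\<open>complex ^ 'n\<close>; since all norms on
  \<open>\<complex>\<^sup>n\<close> are equivalent, this does not depend on the choice of norm.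
\<close>

definition cholomorphic_on ::
  "(complex \<Rightarrow> 'b::real_normed_vector \<Rightarrow> 'b) \<Rightarrow> (complex ^ 'n \<Rightarrow> 'b) \<Rightarrow> (complex ^ 'n) set \<Rightarrow> bool"
  where
  "cholomorphic_on sc f S \<longleftrightarrow>
     (\<forall>z\<in>S. \<exists>D. (f has_derivative D) (at z) \<and> Vector_Spaces.linear (*s) sc D)"

definition cpartial :: "'n \<Rightarrow> (complex ^ 'n \<Rightarrow> complex) \<Rightarrow> complex ^ 'n \<Rightarrow> complex" where
  "cpartial k f z = deriv (\<lambda>t. f (z + t *s axis k 1)) 0"

text \<open>
  A function on the ball is represented by its extension by \<open>0\<close> to all of \<open>\<complex>\<^sup>n\<close>. The extension
  is unique and compatible with the pointwise vector space operations, and as the ball is open, it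
  affects neither holomorphy nor the partial derivatives on the ball.
\<close>

definition HL0 :: "(complex ^ 'n \<Rightarrow> real) \<Rightarrow> (complex ^ 'n \<Rightarrow> complex) set" where
  "HL0 N = {g. (\<forall>z. z \<notin> unit_ball N \<longrightarrow> g z = 0) \<and>
     cholomorphic_on (*) g (unit_ball N) \<and>
     bounded (g ` unit_ball N) \<and>
     (\<exists>C. \<forall>x\<in>unit_ball N. \<forall>y\<in>unit_ball N. cmod (g x - g y) \<le> C * N (x - y)) \<and>
     g 0 = 0}"

definition lip_norm :: "(complex ^ 'n \<Rightarrow> real) \<Rightarrow> (complex ^ 'n \<Rightarrow> complex) \<Rightarrow> real" where
  "lip_norm N g =
     Sup {cmod (g x - g y) / N (x - y) | x y. x \<in> unit_ball N \<and> y \<in> unit_ball N \<and> x \<noteq> y}"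

definition Hinf :: "(complex ^ 'n \<Rightarrow> real) \<Rightarrow> (complex ^ 'n \<Rightarrow> complex ^ 'n) set" where
  "Hinf N = {F. (\<forall>z. z \<notin> unit_ball N \<longrightarrow> F z = 0) \<and>
     cholomorphic_on (*s) F (unit_ball N) \<and>
     bdd_above ((\<lambda>z. dual_norm N (F z)) ` unit_ball N)}"

definition Hinf_norm ::
  "(complex ^ 'n \<Rightarrow> real) \<Rightarrow> (complex ^ 'n \<Rightarrow> complex ^ 'n) \<Rightarrow> real" where
  "Hinf_norm N F = (SUP z\<in>unit_ball N. dual_norm N (F z))"

definition Hinf_s :: "(complex ^ 'n \<Rightarrow> real) \<Rightarrow> (complex ^ 'n \<Rightarrow> complex ^ 'n) set" where
  "Hinf_s N = {F \<in> Hinf N. \<forall>z\<in>unit_ball N. \<forall>j k.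
     cpartial k (\<lambda>u. F u $ j) z = cpartial j (\<lambda>u. F u $ k) z}"

definition differential ::
  "(complex ^ 'n \<Rightarrow> real) \<Rightarrow> (complex ^ 'n \<Rightarrow> complex) \<Rightarrow> (complex ^ 'n \<Rightarrow> complex ^ 'n)" where
  "differential N g = (\<lambda>z. if z \<in> unit_ball N then (\<chi> k. cpartial k g z) else 0)"

end

theory Submission
  imports Defs
begin

text \<open>
  Restricted to a complex line, a holomorphic \<open>g\<close> on the ball is a holomorphic function of one
  variable, with derivative \<open>\<Sum>\<^sub>k \<partial>\<^sub>k g h\<^sub>k\<close> in the direction \<open>h\<close>. Passing to the limit in difference
  quotients shows that a Lipschitz constant of \<open>g\<close> bounds the dual norm of \<open>dg(z)\<close> for each \<open>z\<close>
  (\<open>dual_norm_gradient_le\<close>); as the ball is convex, the mean value inequality on the segment between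
  two points shows that conversely a bound of these dual norms is a Lipschitz constant
  (\<open>lipschitz_of_dual_norm_le\<close>). Hence the differential is isometric. It is clearly linear. The
  Lipschitz bound and \<open>g(0) = 0\<close> also make \<open>g\<close> bounded on the ball.

  That \<open>dg\<close> is itself holomorphic with symmetric derivative rests on Cauchy's formula. On a small
  circle in the direction \<open>e\<^sub>k\<close> it expresses \<open>\<partial>\<^sub>k g(z)\<close> as an integral of the values of \<open>g\<close>. As \<open>g\<close>
  is continuous, this gives continuity of \<open>\<partial>\<^sub>k g\<close> (\<open>continuous_on_cpartial\<close>). So all first partial
  derivatives are continuous, which permits differentiation of the same formula under the integral
  sign: \<open>\<partial>\<^sub>k g\<close> is holomorphic (\<open>cholomorphic_on_cpartial\<close>), and its \<open>j\<close>-th partial derivative is the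
  Cauchy integral of \<open>\<partial>\<^sub>j g\<close>, which is \<open>\<partial>\<^sub>k \<partial>\<^sub>j g\<close> (\<open>cpartial_commute\<close>).

  For surjectivity, a field \<open>F\<close> with symmetric derivative is a closed one-form on a convex
  set that contains \<open>0\<close>, and the Poincare lemma (\<open>closed_form_has_primitive\<close>) provides the primitive
  \<open>g(z) = \<integral>\<^sub>0\<^sup>1 \<Sum>\<^sub>j F\<^sub>j(tz) z\<^sub>j dt\<close>, which is Lipschitz by the estimate above.
\<close>

(* Both formal power series and vectors declare the symbol $ for their coefficients. *)
no_notation fps_nth (infixl \<open>$\<close> 75)

section \<open>Complex gradients\<close>

text \<open>
  The complex bilinear pairing, without conjugation: every complex-linear functional on \<open>\<complex>\<^sup>n\<close> is
  \<open>cdot w\<close> for exactly one \<open>w\<close>, and its operator norm with respect to \<open>N\<close> is \<open>dual_norm N w\<close>.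
\<close>

definition cdot :: "complex ^ 'n \<Rightarrow> complex ^ 'n \<Rightarrow> complex" where
  "cdot w z = (\<Sum>j\<in>UNIV. w $ j * z $ j)"

definition gradient :: "(complex ^ 'n \<Rightarrow> complex) \<Rightarrow> complex ^ 'n \<Rightarrow> complex ^ 'n" where
  "gradient g z = (\<chi> k. cpartial k g z)"

lemma cdot_add_left: "cdot (v + w) z = cdot v z + cdot w z"
  and cdot_add_right: "cdot w (y + z) = cdot w y + cdot w z"
  and cdot_scale_left: "cdot (c *s w) z = c * cdot w z"
  and cdot_scale_right: "cdot w (c *s z) = c * cdot w z"
  by (auto simp: cdot_def algebra_simps sum.distrib sum_distrib_left)

lemma cdot_axis: "cdot w (axis k 1) = w $ k"
  by (simp add: cdot_def axis_def if_distrib cong: if_cong)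

lemma bounded_linear_vector_scale: "bounded_linear (\<lambda>c::complex. c *s h)"
  by (simp add: linear_conv_bounded_linear[symmetric] linear_iff vec_eq_iff algebra_simps)

lemma linear_cdot: "Vector_Spaces.linear (*s) (*) (cdot w)"
  by (simp add: Vector_Spaces.linear_iff cdot_add_right cdot_scale_right
      vec.vector_space_axioms vector_space_over_itself.vector_space_axioms)

lemma linear_functional_eq_cdot:
  fixes D :: "complex ^ 'n \<Rightarrow> complex"
  assumes "Vector_Spaces.linear (*s) (*) D"
  shows "D = cdot (\<chi> k. D (axis k 1))"
proof
  fix h :: "complex ^ 'n"
  interpret Vector_Spaces.linear "(*s)" "(*)" D by fact
  have "D h = D (\<Sum>k\<in>UNIV. h $ k *s axis k 1)"
    by (simp add: basis_expansion)
  also have "\<dots> = cdot (\<chi> k. D (axis k 1)) h"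
    by (simp add: sum scale cdot_def mult.commute)
  finally show "D h = cdot (\<chi> k. D (axis k 1)) h" .
qed

text \<open>
  The link to one complex variable: a function with a complex-linear derivative is holomorphic on
  every complex line.
\<close>

lemma has_field_derivative_along_line:
  assumes "(g has_derivative cdot w) (at (z + t *s h))"
  shows "((\<lambda>u. g (z + u *s h)) has_field_derivative cdot w h) (at t)"
proof -
  have "((\<lambda>u. z + u *s h) has_derivative (\<lambda>u. u *s h)) (at t)"
    by (auto intro!: derivative_eq_intros bounded_linear.has_derivative[OF bounded_linear_vector_scale])
  from diff_chain_at[OF this assms] show ?thesis
    by (simp add: has_field_derivative_def o_def cdot_scale_right mult.commute[of _ "cdot w h"])
qed

text \<open>
  Holomorphy is stated with some complex-linear derivative. Evaluating it along the coordinate axes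
  shows that it can only be the pairing with the vector of partial derivatives.
\<close>

lemma gradient_unique:
  assumes "(g has_derivative cdot w) (at z)"
  shows "gradient g z = w"
proof -
  have "((\<lambda>t. g (z + t *s axis k 1)) has_field_derivative w $ k) (at 0)" for k
    using has_field_derivative_along_line[of g w z 0 "axis k 1"] assms by (simp add: cdot_axis)
  then show ?thesis
    by (simp add: vec_eq_iff gradient_def cpartial_def DERIV_imp_deriv)
qed

lemma cholomorphic_on_scalar_iff:
  "cholomorphic_on (*) g S \<longleftrightarrow> (\<forall>z\<in>S. (g has_derivative cdot (gradient g z)) (at z))"
  unfolding cholomorphic_on_def
  by (metis gradient_unique linear_functional_eq_cdot linear_cdot)

lemma cholomorphic_on_scalarI:
  assumes "\<And>z. z \<in> S \<Longrightarrow> (g has_derivative cdot (w z)) (at z)"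
  shows "cholomorphic_on (*) g S"
  using assms linear_cdot unfolding cholomorphic_on_def by blast

lemma cholomorphic_on_vector_iff:
  fixes F :: "complex ^ 'n \<Rightarrow> complex ^ 'm"
  shows "cholomorphic_on (*s) F S \<longleftrightarrow> (\<forall>k. cholomorphic_on (*) (\<lambda>z. F z $ k) S)"
proof (intro iffI allI)
  fix k
  assume F: "cholomorphic_on (*s) F S"
  show "cholomorphic_on (*) (\<lambda>z. F z $ k) S"
    unfolding cholomorphic_on_def
  proof
    fix z assume "z \<in> S"
    then obtain D where D: "(F has_derivative D) (at z)" "Vector_Spaces.linear (*s) (*s) D"
      using F unfolding cholomorphic_on_def by blast
    have "((\<lambda>z. F z $ k) has_derivative (\<lambda>h. D h $ k)) (at z)"
      by (rule bounded_linear.has_derivative[OF bounded_linear_vec_nth D(1)])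
    moreover have "Vector_Spaces.linear (*s) (*) (\<lambda>h. D h $ k)"
      using D(2) by (simp add: Vector_Spaces.linear_iff vector_space_over_itself.vector_space_axioms)
    ultimately show "\<exists>D. ((\<lambda>z. F z $ k) has_derivative D) (at z) \<and> Vector_Spaces.linear (*s) (*) D"
      by blast
  qed
next
  assume F: "\<forall>k. cholomorphic_on (*) (\<lambda>z. F z $ k) S"
  show "cholomorphic_on (*s) F S"
    unfolding cholomorphic_on_def
  proof
    fix z assume z: "z \<in> S"
    define D where "D = (\<lambda>h. \<Sum>k\<in>UNIV. cdot (gradient (\<lambda>z. F z $ k) z) h *s (axis k 1 :: complex ^ 'm))"
    have *: "((\<lambda>z. F z $ k *s axis k 1) has_derivative
        (\<lambda>h. cdot (gradient (\<lambda>z. F z $ k) z) h *s (axis k 1 :: complex ^ 'm))) (at z)" for k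
      using F z by (intro bounded_linear.has_derivative[OF bounded_linear_vector_scale])
        (simp add: cholomorphic_on_scalar_iff)
    have "((\<lambda>z. \<Sum>k\<in>UNIV. F z $ k *s axis k 1) has_derivative D) (at z)"
      unfolding D_def by (rule has_derivative_sum) (rule *)
    then have "(F has_derivative D) (at z)"
      by (simp add: basis_expansion)
    moreover have "Vector_Spaces.linear (*s) (*s) D"
      by (simp add: Vector_Spaces.linear_iff D_def vec.vector_space_axioms cdot_add_right
          cdot_scale_right sum.distrib vec.scale_left_distrib vec.scale_sum_right)
    ultimately show "\<exists>D. (F has_derivative D) (at z) \<and> Vector_Spaces.linear (*s) (*s) D" by blast
  qed
qed

lemma continuous_on_vector_scale:
  assumes "continuous_on S f" "continuous_on S g"
  shows "continuous_on S (\<lambda>x. (f x :: complex) *s g x)"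
  unfolding vector_scalar_mult_def
  by (intro continuous_on_vec_lambda continuous_on_mult continuous_on_component assms)

lemma gradient_add:
  assumes "cholomorphic_on (*) f S" "cholomorphic_on (*) g S" "z \<in> S"
  shows "gradient (\<lambda>z. f z + g z) z = gradient f z + gradient g z"
    and "((\<lambda>z. f z + g z) has_derivative cdot (gradient f z + gradient g z)) (at z)"
proof -
  have "((\<lambda>z. f z + g z) has_derivative (\<lambda>h. cdot (gradient f z) h + cdot (gradient g z) h)) (at z)"
    using assms unfolding cholomorphic_on_scalar_iff by (intro has_derivative_add) auto
  moreover have "(\<lambda>h. cdot (gradient f z) h + cdot (gradient g z) h) = cdot (gradient f z + gradient g z)"
    by (simp add: fun_eq_iff cdot_add_left)
  ultimately show "((\<lambda>z. f z + g z) has_derivative cdot (gradient f z + gradient g z)) (at z)" by simp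
  then show "gradient (\<lambda>z. f z + g z) z = gradient f z + gradient g z" by (rule gradient_unique)
qed

lemma gradient_mult_left:
  assumes "cholomorphic_on (*) f S" "z \<in> S"
  shows "gradient (\<lambda>z. c * f z) z = c *s gradient f z"
    and "((\<lambda>z. c * f z) has_derivative cdot (c *s gradient f z)) (at z)"
proof -
  have "((\<lambda>z. c * f z) has_derivative (\<lambda>h. c * cdot (gradient f z) h)) (at z)"
    using assms unfolding cholomorphic_on_scalar_iff by (intro has_derivative_mult_right) auto
  moreover have "(\<lambda>h. c * cdot (gradient f z) h) = cdot (c *s gradient f z)"
    by (simp add: fun_eq_iff cdot_scale_left)
  ultimately show "((\<lambda>z. c * f z) has_derivative cdot (c *s gradient f z)) (at z)" by simp
  then show "gradient (\<lambda>z. c * f z) z = c *s gradient f z" by (rule gradient_unique)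
qed

lemma cholomorphic_on_add:
  "cholomorphic_on (*) f S \<Longrightarrow> cholomorphic_on (*) g S \<Longrightarrow> cholomorphic_on (*) (\<lambda>z. f z + g z) S"
  by (rule cholomorphic_on_scalarI) (rule gradient_add)

lemma cholomorphic_on_mult_left:
  "cholomorphic_on (*) f S \<Longrightarrow> cholomorphic_on (*) (\<lambda>z. c * f z) S"
  by (rule cholomorphic_on_scalarI) (rule gradient_mult_left)

lemma cholomorphic_on_zero:
  fixes S :: "(complex ^ 'n) set"
  shows "cholomorphic_on (*) (\<lambda>_. 0) S"
proof (rule cholomorphic_on_scalarI)
  have "cdot (0 :: complex ^ 'n) = (\<lambda>_. 0)" by (simp add: fun_eq_iff cdot_def)
  then show "((\<lambda>_. 0) has_derivative cdot 0) (at z)" for z :: "complex ^ 'n"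
    by simp
qed

lemma cpartial_eq_gradient: "cpartial k f z = gradient f z $ k"
  by (simp add: gradient_def)

section \<open>Differentiation under the integral sign\<close>

text \<open>
  The Leibniz rule for parameter integrals, rephrased for gradients. The general rule asks for
  continuity of the derivative as a bounded linear map; here it suffices that the gradient vector
  depends continuously on point and parameter.
\<close>

lemma has_derivative_integral_param:
  fixes f :: "complex ^ 'n \<Rightarrow> real \<Rightarrow> complex" and p :: "complex ^ 'n \<Rightarrow> real \<Rightarrow> complex ^ 'n"
  assumes U: "open U" "convex U" "x0 \<in> U"
    and f: "\<And>x t. x \<in> U \<Longrightarrow> t \<in> {0..1} \<Longrightarrow> ((\<lambda>x. f x t) has_derivative cdot (p x t)) (at x)"
    and cf: "\<And>x. x \<in> U \<Longrightarrow> continuous_on {0..1} (f x)"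
    and cp: "continuous_on (U \<times> {0..1}) (\<lambda>(x, t). p x t)"
  shows "((\<lambda>x. integral {0..1} (f x)) has_derivative cdot (integral {0..1} (p x0))) (at x0)"
proof -
  define q :: "complex ^ 'n \<Rightarrow> real \<Rightarrow> (complex ^ 'n) \<Rightarrow>\<^sub>L complex" where
    "q x t = (\<Sum>k\<in>UNIV. blinfun_mult_right (p x t $ k) o\<^sub>L Blinfun (\<lambda>h. h $ k))" for x t
  have q_apply: "blinfun_apply (q x t) = cdot (p x t)" for x t
    by (auto simp: fun_eq_iff q_def cdot_def blinfun.sum_left bounded_linear_Blinfun_apply
        bounded_linear_vec_nth)
  have cp': "continuous_on (U \<times> {0..1}) (\<lambda>x. p (fst x) (snd x))"
    using cp by (simp add: case_prod_unfold)
  have cq: "continuous_on (U \<times> cbox 0 1) (\<lambda>(x, t). q x t)"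
    unfolding case_prod_unfold q_def cbox_interval
    by (rule continuous_on_sum, rule bounded_bilinear.continuous_on[OF bounded_bilinear_blinfun_compose],
        rule bounded_linear.continuous_on[OF bounded_linear_blinfun_mult_right],
        rule continuous_on_component, rule cp', rule continuous_on_const)
  have "((\<lambda>x. f x t) has_derivative blinfun_apply (q x t)) (at x within U)"
    if "x \<in> U" "t \<in> cbox 0 1" for x t
    using f[of x t] that has_derivative_at_withinI by (simp add: q_apply)
  moreover have "f x integrable_on cbox 0 1" if "x \<in> U" for x
    using cf[OF that] by (simp add: integrable_continuous_interval)
  ultimately have "((\<lambda>x. integral (cbox 0 1) (f x)) has_derivative
      blinfun_apply (integral (cbox 0 1) (q x0))) (at x0 within U)"
    by (rule leibniz_rule[where f = f and fx = q and U = U and ?x0.0 = x0 and a = 0 and b = 1,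
          OF _ _ cq U(3,2)])
  moreover have "blinfun_apply (integral {0..1} (q x0)) = cdot (integral {0..1} (p x0))"
  proof
    fix h :: "complex ^ 'n"
    have slice: "continuous_on {0..1} (Pair x0)" "Pair x0 ` {0..1} \<subseteq> U \<times> {0..1::real}"
      using U by (auto intro!: continuous_intros)
    have iq: "q x0 integrable_on {0..1}"
      using continuous_on_compose2[OF cq[unfolded cbox_interval] slice]
      by (simp add: integrable_continuous_interval)
    have ip: "p x0 integrable_on {0..1}"
      using continuous_on_compose2[OF cp slice] by (simp add: integrable_continuous_interval)
    have bl: "bounded_linear (\<lambda>w. cdot w h)"
      unfolding linear_conv_bounded_linear[symmetric] linear_iff
      by (auto simp: cdot_def scaleR_sum_right sum.distrib algebra_simps)
    have "blinfun_apply (integral {0..1} (q x0)) h = integral {0..1} (\<lambda>t. blinfun_apply (q x0 t) h)"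
      using integral_linear[OF iq blinfun.bounded_linear_left[of h]] by (simp add: o_def)
    also have "\<dots> = integral {0..1} (\<lambda>t. cdot (p x0 t) h)" by (simp add: q_apply)
    also have "\<dots> = cdot (integral {0..1} (p x0)) h"
      using integral_linear[OF ip bl] by (simp add: o_def)
    finally show "blinfun_apply (integral {0..1} (q x0)) h = cdot (integral {0..1} (p x0)) h" .
  qed
  ultimately show ?thesis
    by (simp only: at_within_open[OF U(3,1)] cbox_interval)
qed

section \<open>Cauchy's formula for partial derivatives\<close>

definition circle_point :: "real \<Rightarrow> real \<Rightarrow> complex" where
  "circle_point r \<theta> = of_real r * exp (2 * of_real pi * \<i> * of_real \<theta>)"

lemma norm_circle_point: "0 \<le> r \<Longrightarrow> cmod (circle_point r \<theta>) = r"
  by (simp add: circle_point_def norm_mult)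

lemma circle_point_nonzero: "0 < r \<Longrightarrow> circle_point r \<theta> \<noteq> 0"
  by (simp add: circle_point_def)

lemma continuous_on_circle_point: "continuous_on A h \<Longrightarrow> continuous_on A (\<lambda>x. circle_point r (h x))"
  unfolding circle_point_def by (intro continuous_intros)

text \<open>
  Cauchy's formula for the first derivative. With \<open>u = circle_point r \<theta>\<close>, \<open>du = 2\<pi>\<i> u d\<theta>\<close> cancels one of the
  two factors \<open>u\<close> in the denominator and the factor \<open>1 / (2\<pi>\<i>)\<close> in front.
\<close>

lemma deriv_eq_integral_circle:
  assumes "f holomorphic_on cball 0 r" "0 < r"
  shows "deriv f 0 = integral {0..1} (\<lambda>\<theta>. f (circle_point r \<theta>) / circle_point r \<theta>)"
proof -
  have *: "((\<lambda>u. f u / (u - 0) ^ Suc 1) has_contour_integral ((2 * pi * \<i>) / fact 1 * (deriv ^^ 1) f 0))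
         (circlepath 0 r)"
    using assms by (intro Cauchy_has_contour_integral_higher_derivative_circlepath)
      (auto intro: holomorphic_on_imp_continuous_on holomorphic_on_subset)
  have path: "circlepath 0 r \<theta> = circle_point r \<theta>" for \<theta>
    by (simp add: circlepath circle_point_def)
  have vd: "vector_derivative (circlepath 0 r) (at \<theta>) = 2 * pi * \<i> * circle_point r \<theta>" for \<theta>
    by (simp add: vector_derivative_circlepath circle_point_def)
  have "((\<lambda>\<theta>. (2 * pi * \<i>) * (f (circle_point r \<theta>) / circle_point r \<theta>)) has_integral (2 * pi * \<i>) * deriv f 0) {0..1}"
    using * unfolding has_contour_integral path vd
    by (rule has_integral_eq_rhs[OF has_integral_eq, rotated])
      (use assms in \<open>auto simp: power2_eq_square circle_point_nonzero\<close>)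
  from has_integral_mult_right[OF this, of "1 / (2 * pi * \<i>)"]
  show ?thesis by (auto dest!: integral_unique)
qed

lemma norm_scale_axis: "norm (t *s axis k (1::complex)) = cmod t"
proof -
  have "t *s axis k (1::complex) = axis k t"
    by (simp add: vec_eq_iff axis_def)
  then show ?thesis
    by (simp add: norm_vec_def L2_set_def axis_def if_distrib[of norm] if_distrib[of "\<lambda>x. x\<^sup>2"] cong: if_cong)
qed

text \<open>
  One radius that works for all centres near \<open>z0\<close>: the circle in Cauchy's formula must not move
  with the point when the formula is differentiated.
\<close>

lemma open_contains_discs:
  fixes S :: "(complex ^ 'n) set"
  assumes "open S" "z0 \<in> S"
  obtains r where "0 < r" "\<And>x t. x \<in> ball z0 r \<Longrightarrow> cmod t \<le> r \<Longrightarrow> x + t *s axis k 1 \<in> S"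
proof -
  obtain e where e: "0 < e" "ball z0 e \<subseteq> S"
    using assms open_contains_ball by blast
  have "x + t *s axis k 1 \<in> S" if "x \<in> ball z0 (e / 2)" "cmod t \<le> e / 2" for x t
  proof -
    have "dist z0 (x + t *s axis k 1) \<le> dist z0 x + dist x (x + t *s axis k 1)"
      by (rule dist_triangle)
    also have "dist x (x + t *s axis k 1) = cmod t"
      by (simp add: dist_norm norm_scale_axis)
    finally have "dist z0 (x + t *s axis k 1) < e" using that by simp
    then show ?thesis using e by auto
  qed
  then show ?thesis using that[of "e / 2"] e by simp
qed

lemma cpartial_eq_integral_circle:
  assumes g: "cholomorphic_on (*) g S" and r: "0 < r"
    and S: "\<And>t. cmod t \<le> r \<Longrightarrow> z + t *s axis k 1 \<in> S"
  shows "cpartial k g z = integral {0..1} (\<lambda>\<theta>. g (z + circle_point r \<theta> *s axis k 1) / circle_point r \<theta>)"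
proof -
  have "(\<lambda>t. g (z + t *s axis k 1)) holomorphic_on cball 0 r"
  proof (rule holomorphic_onI)
    fix t assume "t \<in> cball (0::complex) r"
    then have "(g has_derivative cdot (gradient g (z + t *s axis k 1))) (at (z + t *s axis k 1))"
      using g S[of t] by (simp add: cholomorphic_on_scalar_iff)
    from has_field_derivative_along_line[OF this]
    show "(\<lambda>t. g (z + t *s axis k 1)) field_differentiable at t within cball 0 r"
      using field_differentiable_at_within field_differentiable_def by blast
  qed
  from deriv_eq_integral_circle[OF this r] show ?thesis
    by (simp add: cpartial_def)
qed

lemma cholomorphic_on_imp_continuous_on:
  "cholomorphic_on (*) g S \<Longrightarrow> continuous_on S g"
  unfolding cholomorphic_on_scalar_iff
  using has_derivative_continuous continuous_at_imp_continuous_on by blast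

lemma continuous_on_shift_circle_point:
  assumes h: "continuous_on S h" and sub: "\<And>x t. x \<in> U \<Longrightarrow> cmod t \<le> r \<Longrightarrow> x + t *s axis k 1 \<in> S"
    and r: "0 < r"
  shows "continuous_on (U \<times> T) (\<lambda>(x, \<theta>). h (x + circle_point r \<theta> *s axis k 1))"
  unfolding case_prod_unfold
proof (rule continuous_on_compose2[OF h])
  show "continuous_on (U \<times> T) (\<lambda>x. fst x + circle_point r (snd x) *s axis k 1)"
    by (intro continuous_on_add continuous_on_vector_scale continuous_on_circle_point
        continuous_on_fst continuous_on_snd continuous_on_id continuous_on_const)
qed (use sub r in \<open>auto simp: norm_circle_point\<close>)

text \<open>
  In Cauchy's formula the partial derivative is a parameter integral of \<open>g\<close> itself, so the continuity
  of \<open>g\<close> is enough.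
\<close>

lemma continuous_on_cpartial:
  assumes "open S" "cholomorphic_on (*) g S"
  shows "continuous_on S (cpartial k g)"
proof (rule continuous_at_imp_continuous_on, rule ballI)
  fix z0 assume "z0 \<in> S"
  obtain r where r: "0 < r"
    and rS: "\<And>x t. x \<in> ball z0 r \<Longrightarrow> cmod t \<le> r \<Longrightarrow> x + t *s axis k 1 \<in> S"
    using open_contains_discs[OF assms(1) \<open>z0 \<in> S\<close>] by blast
  have "continuous_on (ball z0 r \<times> {0..1}) (\<lambda>(x, \<theta>). g (x + circle_point r \<theta> *s axis k 1))"
    using continuous_on_shift_circle_point[OF cholomorphic_on_imp_continuous_on[OF assms(2)] rS r] .
  moreover have "continuous_on (ball z0 r \<times> {0..1}) (\<lambda>x. circle_point r (snd x))"
    by (intro continuous_on_circle_point continuous_on_snd continuous_on_id)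
  ultimately have "continuous_on (ball z0 r \<times> {0..1})
      (\<lambda>(x, \<theta>). g (x + circle_point r \<theta> *s axis k 1) / circle_point r \<theta>)"
    unfolding case_prod_unfold by (rule continuous_on_divide) (simp add: circle_point_nonzero r)
  then have "continuous_on (ball z0 r)
      (\<lambda>x. integral {0..1} (\<lambda>\<theta>. g (x + circle_point r \<theta> *s axis k 1) / circle_point r \<theta>))"
    using integral_continuous_on_param[of "ball z0 r" 0 1
        "\<lambda>x \<theta>. g (x + circle_point r \<theta> *s axis k 1) / circle_point r \<theta>"] by (simp add: cbox_interval)
  then have "continuous_on (ball z0 r) (cpartial k g)"
    by (rule continuous_on_eq) (use cpartial_eq_integral_circle[OF assms(2) r] rS in auto)
  then show "isCont (cpartial k g) z0"
    using r by (simp add: continuous_on_eq_continuous_at)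
qed

lemma continuous_on_gradient:
  assumes "open S" "cholomorphic_on (*) g S"
  shows "continuous_on S (gradient g)"
  unfolding gradient_def
  by (intro continuous_on_vec_lambda) (rule continuous_on_cpartial[OF assms])

text \<open>
  By continuity of all partial derivatives of \<open>g\<close>, Cauchy's formula for \<open>\<partial>\<^sub>k g\<close> may be differentiated
  under the integral sign. The formula for the derivative is recorded, not only its existence, since
  the symmetry of second derivatives is read off from it.
\<close>

lemma cpartial_has_derivative_integral:
  assumes S: "open S" "cholomorphic_on (*) g S" and z0: "z0 \<in> S"
  obtains r where "0 < r" "\<And>t. cmod t \<le> r \<Longrightarrow> z0 + t *s axis k 1 \<in> S"
    "(cpartial k g has_derivative
       cdot (integral {0..1} (\<lambda>\<theta>. (1 / circle_point r \<theta>) *s gradient g (z0 + circle_point r \<theta> *s axis k 1)))) (at z0)"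
    "(\<lambda>\<theta>. (1 / circle_point r \<theta>) *s gradient g (z0 + circle_point r \<theta> *s axis k 1)) integrable_on {0..1}"
proof -
  obtain r where r: "0 < r"
    and rS: "\<And>x t. x \<in> ball z0 r \<Longrightarrow> cmod t \<le> r \<Longrightarrow> x + t *s axis k 1 \<in> S"
    using open_contains_discs[OF S(1) z0] by blast
  let ?f = "\<lambda>x \<theta>. g (x + circle_point r \<theta> *s axis k 1) / circle_point r \<theta>"
  let ?p = "\<lambda>x \<theta>. (1 / circle_point r \<theta>) *s gradient g (x + circle_point r \<theta> *s axis k 1)"
  have slice: "continuous_on {0..1} (Pair x)" "Pair x ` {0..1} \<subseteq> ball z0 r \<times> {0..1::real}"
    if "x \<in> ball z0 r" for x
    using that by (auto intro!: continuous_intros)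
  have inv: "continuous_on (ball z0 r \<times> {0..1}) (\<lambda>x. 1 / circle_point r (snd x))"
    by (intro continuous_on_divide continuous_on_const continuous_on_circle_point continuous_on_snd
        continuous_on_id) (simp add: circle_point_nonzero r)
  have cf: "continuous_on (ball z0 r \<times> {0..1}) (\<lambda>(x, \<theta>). ?f x \<theta>)"
    using continuous_on_mult[OF inv continuous_on_shift_circle_point[OF cholomorphic_on_imp_continuous_on[OF S(2)] rS r,
        unfolded case_prod_unfold]]
    by (simp add: case_prod_unfold)
  have cp: "continuous_on (ball z0 r \<times> {0..1}) (\<lambda>(x, \<theta>). ?p x \<theta>)"
    using continuous_on_vector_scale[OF inv continuous_on_shift_circle_point[OF continuous_on_gradient[OF S] rS r,
        unfolded case_prod_unfold]]
    by (simp add: case_prod_unfold)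
  have "((\<lambda>x. integral {0..1} (?f x)) has_derivative cdot (integral {0..1} (?p z0))) (at z0)"
  proof (rule has_derivative_integral_param[of "ball z0 r"])
    fix x and \<theta> :: real assume x: "x \<in> ball z0 r"
    let ?y = "x + circle_point r \<theta> *s axis k 1"
    have "(g has_derivative cdot (gradient g ?y)) (at ?y)"
      using S(2) rS[OF x, of "circle_point r \<theta>"] r by (simp add: cholomorphic_on_scalar_iff norm_circle_point)
    moreover have "((\<lambda>x. x + circle_point r \<theta> *s axis k 1) has_derivative (\<lambda>h. h)) (at x)"
      by (auto intro!: derivative_eq_intros)
    ultimately have "((\<lambda>x. g (x + circle_point r \<theta> *s axis k 1)) has_derivative cdot (gradient g ?y)) (at x)"
      using diff_chain_at[of "\<lambda>x. x + circle_point r \<theta> *s axis k 1" "\<lambda>h. h" x g] by (simp add: o_def)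
    from has_derivative_mult_right[OF this, of "1 / circle_point r \<theta>"]
    show "((\<lambda>x. ?f x \<theta>) has_derivative cdot (?p x \<theta>)) (at x)"
      by (simp add: cdot_scale_left[abs_def])
  next
    show "continuous_on {0..1} (?f x)" if "x \<in> ball z0 r" for x
      using continuous_on_compose2[OF cf slice[OF that]] by simp
  qed (use cp r in auto)
  then have "(cpartial k g has_derivative cdot (integral {0..1} (?p z0))) (at z0)"
  proof (rule has_derivative_transform_within_open)
    show "integral {0..1} (?f x) = cpartial k g x" if "x \<in> ball z0 r" for x
      using cpartial_eq_integral_circle[OF S(2) r rS[OF that]] by simp
  qed (use r in auto)
  moreover have "?p z0 integrable_on {0..1}"
    using continuous_on_compose2[OF cp slice[of z0]] r by (simp add: integrable_continuous_interval)
  ultimately show ?thesis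
    using r rS[of z0] by (intro that[of r]) auto
qed

lemma cholomorphic_on_cpartial:
  assumes "open S" "cholomorphic_on (*) g S"
  shows "cholomorphic_on (*) (cpartial k g) S"
proof (rule cholomorphic_on_scalarI)
  fix z assume z: "z \<in> S"
  obtain w where "(cpartial k g has_derivative cdot w) (at z)"
    using cpartial_has_derivative_integral[OF assms z] by blast
  then show "(cpartial k g has_derivative cdot (gradient (cpartial k g) z)) (at z)"
    using gradient_unique by metis
qed

text \<open>
  The \<open>j\<close>-th entry of the integral that represents the gradient of \<open>\<partial>\<^sub>k g\<close> is the Cauchy integral in
  direction \<open>e\<^sub>k\<close> of the holomorphic function \<open>\<partial>\<^sub>j g\<close>.
\<close>

lemma cpartial_commute:
  assumes S: "open S" "cholomorphic_on (*) g S" and z: "z \<in> S"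
  shows "cpartial j (cpartial k g) z = cpartial k (cpartial j g) z"
proof (rule cpartial_has_derivative_integral[OF assms, where k = k])
  fix r :: real
  let ?p = "\<lambda>\<theta>. (1 / circle_point r \<theta>) *s gradient g (z + circle_point r \<theta> *s axis k 1)"
  assume r: "0 < r" "\<And>t. cmod t \<le> r \<Longrightarrow> z + t *s axis k 1 \<in> S"
    and d: "(cpartial k g has_derivative cdot (integral {0..1} ?p)) (at z)"
    and i: "?p integrable_on {0..1}"
  have "cpartial j (cpartial k g) z = gradient (cpartial k g) z $ j"
    by (simp add: gradient_def)
  also have "\<dots> = integral {0..1} ?p $ j"
    by (simp add: gradient_unique[OF d])
  also have "\<dots> = integral {0..1} (\<lambda>\<theta>. cpartial j g (z + circle_point r \<theta> *s axis k 1) / circle_point r \<theta>)"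
    using integral_linear[OF i bounded_linear_vec_nth[of j]] by (simp add: o_def gradient_def)
  also have "\<dots> = cpartial k (cpartial j g) z"
    using cpartial_eq_integral_circle[OF cholomorphic_on_cpartial[OF S] r] by simp
  finally show ?thesis .
qed

section \<open>The Poincare lemma\<close>

text \<open>
  Differentiating \<open>\<integral>\<^sub>0\<^sup>1 \<Sum>\<^sub>j F\<^sub>j(tz) z\<^sub>j dt\<close> in \<open>z\<close> and using the symmetry of the
  derivative of \<open>F\<close>, the \<open>k\<close>-th entry of the gradient of the integrand is
  \<open>F\<^sub>k(tz) + t \<Sum>\<^sub>j \<partial>\<^sub>j F\<^sub>k(tz) z\<^sub>j\<close>. This is the derivative of \<open>t F\<^sub>k(tz)\<close> in \<open>t\<close>, so its integral is \<open>F\<^sub>k(z)\<close>.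
\<close>

lemma closed_form_has_primitive:
  fixes F :: "complex ^ 'n \<Rightarrow> complex ^ 'n"
  assumes U: "open U" "convex U" "0 \<in> U"
    and F: "cholomorphic_on (*s) F U"
    and sym: "\<And>z j k. z \<in> U \<Longrightarrow> cpartial k (\<lambda>u. F u $ j) z = cpartial j (\<lambda>u. F u $ k) z"
  obtains g where "g 0 = 0" "\<And>z. z \<in> U \<Longrightarrow> (g has_derivative cdot (F z)) (at z)"
proof -
  let ?G = "\<lambda>k. gradient (\<lambda>u. F u $ k)"
  define f where "f z t = cdot (F (of_real t *s z)) z" for z and t :: real
  \<comment> \<open>the gradient of \<open>f\<close> in its first argument, and also the derivative of \<open>t F(tz)\<close> in \<open>t\<close>\<close>
  define p where "p z t = (\<chi> k. F (of_real t *s z) $ k + of_real t * cdot (?G k (of_real t *s z)) z)"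
    for z and t :: real
  have holo: "cholomorphic_on (*) (\<lambda>u. F u $ k) U" for k
    using F cholomorphic_on_vector_iff by blast
  have dF: "((\<lambda>u. F u $ k) has_derivative cdot (?G k z)) (at z)" if "z \<in> U" for k z
    using holo that by (simp add: cholomorphic_on_scalar_iff)
  have scaled: "of_real t *s z \<in> U" if "z \<in> U" "t \<in> {0..1}" for z and t :: real
  proof -
    have "t *\<^sub>R z + (1 - t) *\<^sub>R 0 \<in> U"
      using that by (intro convexD[OF U(2)] U(3)) auto
    moreover have "of_real t *s z = t *\<^sub>R z"
      by (simp add: vec_eq_iff scaleR_conv_of_real[where 'a = complex])
    ultimately show ?thesis by simp
  qed
  have c_scaled: "continuous_on (U \<times> {0..1}) (\<lambda>x. h (of_real (snd x) *s fst x))"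
    if "continuous_on U h" for h :: "complex ^ 'n \<Rightarrow> complex"
  proof (rule continuous_on_compose2[OF that])
    show "continuous_on (U \<times> {0..1}) (\<lambda>x. complex_of_real (snd x) *s fst x)"
      by (intro continuous_on_vector_scale continuous_on_of_real continuous_on_snd
          continuous_on_fst continuous_on_id)
  qed (use scaled in auto)
  have cF: "continuous_on U (\<lambda>u. F u $ k)" for k
    by (rule cholomorphic_on_imp_continuous_on[OF holo])
  have cG: "continuous_on U (\<lambda>z. ?G k z $ j)" for k j
    by (rule continuous_on_component[OF continuous_on_gradient[OF U(1) holo]])
  have c_fst: "continuous_on (U \<times> {0..1::real}) (\<lambda>x. fst x $ j)" for j
    by (intro continuous_on_component continuous_on_fst continuous_on_id)
  have c_snd: "continuous_on (U \<times> {0..1}) (\<lambda>x. complex_of_real (snd x))"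
    by (intro continuous_on_of_real continuous_on_snd continuous_on_id)
  have cp: "continuous_on (U \<times> {0..1}) (\<lambda>(x, t). p x t)"
    unfolding case_prod_unfold p_def cdot_def
    by (intro continuous_on_vec_lambda continuous_on_add continuous_on_mult continuous_on_sum
        c_scaled cF cG c_fst c_snd)
  have cf: "continuous_on (U \<times> {0..1}) (\<lambda>(x, t). f x t)"
    unfolding case_prod_unfold f_def cdot_def
    by (intro continuous_on_mult continuous_on_sum c_scaled cF c_fst)
  have slice: "continuous_on {0..1} (Pair x)" "Pair x ` {0..1} \<subseteq> U \<times> {0..1::real}"
    if "x \<in> U" for x
    using that by (auto intro!: continuous_intros)
  have df: "((\<lambda>x. f x t) has_derivative cdot (p x t)) (at x)"
    if x: "x \<in> U" and t: "t \<in> {0..1}" for x t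
  proof -
    let ?y = "complex_of_real t *s x"
    have p_nth: "p x t $ k = F ?y $ k + of_real t * cdot (?G k ?y) x" for k
      by (simp add: p_def)
    have lin: "((\<lambda>x. complex_of_real t *s x) has_derivative (\<lambda>h. of_real t *s h)) (at x)"
      by (intro bounded_linear.has_derivative[where f = "\<lambda>x. complex_of_real t *s x"] has_derivative_ident)
        (simp add: linear_conv_bounded_linear[symmetric] linear_iff vec_eq_iff algebra_simps)
    have Fj: "((\<lambda>x. F (of_real t *s x) $ j) has_derivative (\<lambda>h. of_real t * cdot (?G j ?y) h)) (at x)" for j
      using diff_chain_at[OF lin dF[OF scaled[OF x t], of j]] by (simp add: o_def cdot_scale_right)
    have xj: "((\<lambda>x. x $ j) has_derivative (\<lambda>h. h $ j)) (at x)" for j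
      by (rule bounded_linear.has_derivative[OF bounded_linear_vec_nth has_derivative_ident])
    have "((\<lambda>x. f x t) has_derivative
      (\<lambda>h. \<Sum>j\<in>UNIV. F ?y $ j * h $ j + of_real t * cdot (?G j ?y) h * x $ j)) (at x)"
      unfolding f_def cdot_def[of "F _"] by (rule has_derivative_sum) (rule has_derivative_mult[OF Fj xj])
    \<comment> \<open>In the second summand the symmetry of the derivative of \<open>F\<close> lets \<open>h\<close> and \<open>x\<close> change places.\<close>
    moreover have "(\<Sum>j\<in>UNIV. F ?y $ j * h $ j + of_real t * cdot (?G j ?y) h * x $ j) = cdot (p x t) h" for h
    proof -
      have "(\<Sum>j\<in>UNIV. cdot (?G j ?y) h * x $ j) = (\<Sum>j\<in>UNIV. \<Sum>k\<in>UNIV. ?G j ?y $ k * h $ k * x $ j)"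
        by (simp add: cdot_def sum_distrib_right)
      also have "\<dots> = (\<Sum>k\<in>UNIV. \<Sum>j\<in>UNIV. ?G j ?y $ k * h $ k * x $ j)"
        by (rule sum.swap)
      also have "\<dots> = (\<Sum>k\<in>UNIV. \<Sum>j\<in>UNIV. ?G k ?y $ j * x $ j * h $ k)"
        using sym[OF scaled[OF x t]] by (simp add: gradient_def mult_ac)
      also have "\<dots> = (\<Sum>k\<in>UNIV. cdot (?G k ?y) x * h $ k)"
        by (simp add: cdot_def sum_distrib_right)
      finally have swap: "(\<Sum>j\<in>UNIV. cdot (?G j ?y) h * x $ j) = (\<Sum>k\<in>UNIV. cdot (?G k ?y) x * h $ k)" .
      have "(\<Sum>j\<in>UNIV. F ?y $ j * h $ j + of_real t * cdot (?G j ?y) h * x $ j)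
          = (\<Sum>j\<in>UNIV. F ?y $ j * h $ j) + of_real t * (\<Sum>j\<in>UNIV. cdot (?G j ?y) h * x $ j)"
        by (simp add: sum.distrib sum_distrib_left mult.assoc)
      also have "\<dots> = cdot (p x t) h"
        unfolding swap cdot_def[of "p x t"]
        by (simp add: p_nth distrib_right sum.distrib sum_distrib_left mult.assoc)
      finally show ?thesis .
    qed
    ultimately show ?thesis by simp
  qed
  have int_p: "integral {0..1} (p z) = F z" if z: "z \<in> U" for z
  proof -
    have "p z integrable_on {0..1}"
      using continuous_on_compose2[OF cp slice[OF z]] by (simp add: integrable_continuous_interval)
    from integral_linear[OF this bounded_linear_vec_nth]
    have comp: "integral {0..1} (p z) $ k = integral {0..1} (\<lambda>t. p z t $ k)" for k
      by (simp add: o_def)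
    have "((\<lambda>t. p z t $ k) has_integral
        (of_real 1 * F (of_real 1 *s z) $ k - of_real 0 * F (of_real 0 *s z) $ k)) {0..1}" for k
    proof (rule fundamental_theorem_of_calculus)
      fix t :: real assume t: "t \<in> {0..1}"
      have "((\<lambda>u. F (0 + u *s z) $ k) has_field_derivative cdot (?G k (of_real t *s z)) z) (at (of_real t))"
        using has_field_derivative_along_line[of "\<lambda>u. F u $ k" _ 0] dF[OF scaled[OF z t]] by simp
      then have "((\<lambda>u. u * F (u *s z) $ k) has_field_derivative p z t $ k) (at (of_real t))"
        by (auto intro!: derivative_eq_intros simp: p_def)
      then show "((\<lambda>t. of_real t * F (of_real t *s z) $ k) has_vector_derivative p z t $ k) (at t within {0..1})"
        by (rule has_vector_derivative_real_field)
    qed simp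
    then show ?thesis
      by (simp add: vec_eq_iff comp integral_unique)
  qed
  show ?thesis
  proof (rule that[of "\<lambda>z. integral {0..1} (f z)"])
    show "integral {0..1} (f 0) = 0"
    proof -
      have "f 0 = (\<lambda>_. 0)" by (simp add: fun_eq_iff f_def cdot_def)
      then show ?thesis by simp
    qed
    show "((\<lambda>z. integral {0..1} (f z)) has_derivative cdot (F z)) (at z)" if z: "z \<in> U" for z
      unfolding int_p[OF z, symmetric]
    proof (rule has_derivative_integral_param[OF U(1,2) z df _ cp])
      show "continuous_on {0..1} (f x)" if "x \<in> U" for x
        using continuous_on_compose2[OF cf slice[OF that]] by simp
    qed
  qed
qed

section \<open>Norms and dual norms on \<open>\<complex>\<^sup>n\<close>\<close>

text \<open>
  One inequality suffices for homogeneity: for \<open>c \<noteq> 0\<close> it also applies to \<open>1 / c\<close> and the vector scaled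
  by \<open>c\<close>.
\<close>

lemma cnormed_spaceI:
  assumes "module sc" "module.subspace sc V"
    and nonneg: "\<And>x. x \<in> V \<Longrightarrow> 0 \<le> M x"
    and zero: "\<And>x. x \<in> V \<Longrightarrow> M x = 0 \<longleftrightarrow> x = 0"
    and scale_le: "\<And>c x. x \<in> V \<Longrightarrow> M (sc c x) \<le> cmod c * M x"
    and triangle: "\<And>x y. x \<in> V \<Longrightarrow> y \<in> V \<Longrightarrow> M (x + y) \<le> M x + M y"
  shows "cnormed_space sc V M"
proof -
  interpret module sc by fact
  have "M (sc c x) = cmod c * M x" if x: "x \<in> V" for c x
  proof (cases "c = 0")
    case True
    then show ?thesis using zero[of 0] subspace_0[OF assms(2)] by simp
  next
    case False
    have "M x = M (sc (1 / c) (sc c x))" using False by simp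
    also have "\<dots> \<le> cmod (1 / c) * M (sc c x)"
      by (rule scale_le) (rule subspace_scale[OF assms(2) x])
    finally have "cmod c * M x \<le> M (sc c x)"
      using False by (simp add: norm_divide field_simps)
    then show ?thesis using scale_le[OF x, of c] by simp
  qed
  then show ?thesis
    using assms unfolding cnormed_space_def by blast
qed

locale vector_norm =
  fixes N :: "complex ^ 'n \<Rightarrow> real"
  assumes cnormed_space_N: "cnormed_space (*s) UNIV N"
begin

lemma N_nonneg: "0 \<le> N x"
  and N_eq_0_iff: "N x = 0 \<longleftrightarrow> x = 0"
  and N_scale: "N (c *s x) = cmod c * N x"
  and N_triangle: "N (x + y) \<le> N x + N y"
  using cnormed_space_N by (auto simp: cnormed_space_def)

lemma N_0: "N 0 = 0"
  by (simp add: N_eq_0_iff)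

lemma N_pos: "x \<noteq> 0 \<Longrightarrow> 0 < N x"
  using N_nonneg[of x] N_eq_0_iff[of x] by linarith

lemma N_minus_commute: "N (x - y) = N (y - x)"
proof -
  have "y - x = (-1) *s (x - y)" by (simp add: vec_eq_iff)
  then show ?thesis by (simp only: N_scale) simp
qed

lemma N_scaleR: "N (t *\<^sub>R x) = \<bar>t\<bar> * N x"
proof -
  have "t *\<^sub>R x = of_real t *s x"
    by (simp add: vec_eq_iff scaleR_conv_of_real[where 'a = complex])
  then show ?thesis by (simp add: N_scale)
qed

text \<open>
  Together with the reverse estimate \<open>norm_le_N\<close>, this is the equivalence of \<open>N\<close> with the Euclidean
  norm. It makes the unit ball open in the topology in which derivatives are taken.
\<close>

lemma N_le_norm:
  obtains K where "0 \<le> K" "\<And>x. N x \<le> K * norm x"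
proof
  let ?K = "\<Sum>k\<in>UNIV. N (axis k 1)"
  show "0 \<le> ?K" by (simp add: N_nonneg sum_nonneg)
  fix x
  have sum_le: "N (\<Sum>k\<in>A. f k) \<le> (\<Sum>k\<in>A. N (f k))" if "finite A" for A and f :: "'n \<Rightarrow> complex ^ 'n"
    using that
    by induction (auto simp: N_0 intro: order_trans[OF N_triangle])
  have "N x = N (\<Sum>k\<in>UNIV. x $ k *s axis k 1)"
    by (simp add: basis_expansion)
  also have "\<dots> \<le> (\<Sum>k\<in>UNIV. N (x $ k *s axis k 1))"
    by (rule sum_le) simp
  also have "\<dots> \<le> (\<Sum>k\<in>UNIV. norm x * N (axis k 1))"
    by (intro sum_mono) (simp add: N_scale mult_right_mono N_nonneg Finite_Cartesian_Product.norm_nth_le)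
  finally show "N x \<le> ?K * norm x"
    by (simp add: sum_distrib_left mult.commute)
qed

lemma continuous_on_N: "continuous_on S N"
proof -
  obtain K where K: "0 \<le> K" "\<And>x. N x \<le> K * norm x"
    using N_le_norm by blast
  have "dist (N x) (N y) \<le> K * dist x y" for x y
  proof -
    have "N x \<le> N (x - y) + N y" "N y \<le> N (y - x) + N x"
      using N_triangle[of "x - y" y] N_triangle[of "y - x" x] by auto
    then have "\<bar>N x - N y\<bar> \<le> N (x - y)"
      by (simp add: N_minus_commute[of y x])
    also have "\<dots> \<le> K * norm (x - y)" by (rule K)
    finally show ?thesis by (simp add: dist_norm)
  qed
  then have "K-lipschitz_on S N" using K by (intro lipschitz_onI)
  then show ?thesis by (rule lipschitz_on_continuous_on)
qed

text \<open>
  By compactness, \<open>N\<close> attains a positive minimum on the Euclidean unit sphere.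
\<close>

lemma norm_le_N:
  obtains C where "0 < C" "\<And>x. norm x \<le> C * N x"
proof -
  have ne: "sphere (0 :: complex ^ 'n) 1 \<noteq> {}" by simp
  obtain u :: "complex ^ 'n" where u: "u \<in> sphere 0 1" and min: "\<And>x. x \<in> sphere 0 1 \<Longrightarrow> N u \<le> N x"
    using continuous_attains_inf[OF compact_sphere ne continuous_on_N] by blast
  have "0 < N u" using u by (intro N_pos) auto
  moreover have "norm x \<le> 1 / N u * N x" for x
  proof (cases "x = 0")
    case False
    have "N u \<le> N ((1 / norm x) *\<^sub>R x)"
      using False by (intro min) simp
    then show ?thesis
      using False \<open>0 < N u\<close> by (simp add: N_scaleR field_simps)
  qed (simp add: N_0)
  ultimately show ?thesis by (intro that[of "1 / N u"]) auto
qed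

lemma zero_in_unit_ball: "0 \<in> unit_ball N"
  by (simp add: unit_ball_def N_0)

lemma open_unit_ball: "open (unit_ball N)"
  unfolding unit_ball_def by (intro open_Collect_less continuous_on_N continuous_on_const)

lemma convex_unit_ball: "convex (unit_ball N)"
proof (rule convexI)
  fix x y and u v :: real
  assume *: "x \<in> unit_ball N" "y \<in> unit_ball N" "0 \<le> u" "0 \<le> v" "u + v = 1"
  have "N (u *\<^sub>R x + v *\<^sub>R y) \<le> u * N x + v * N y"
    using N_triangle[of "u *\<^sub>R x" "v *\<^sub>R y"] * by (simp add: N_scaleR)
  also have "\<dots> < 1"
    using * by (intro convex_bound_lt) (auto simp: unit_ball_def)
  finally show "u *\<^sub>R x + v *\<^sub>R y \<in> unit_ball N" by (simp add: unit_ball_def)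
qed

text \<open>
  Without this bound the supremum in the dual norm would be an unspecified number.
\<close>

lemma bdd_above_dual: "bdd_above ((\<lambda>z. cmod (cdot w z)) ` {z. N z \<le> 1})"
proof -
  obtain C where C: "0 < C" "\<And>x. norm x \<le> C * N x" using norm_le_N by blast
  have "cmod (cdot w z) \<le> (\<Sum>j\<in>UNIV. cmod (w $ j) * C)" if "N z \<le> 1" for z
  proof -
    have "norm z \<le> C"
      using C(2)[of z] mult_left_mono[OF that, of C] C(1) by linarith
    then have "cmod (z $ j) \<le> C" for j
      using Finite_Cartesian_Product.norm_nth_le[of z j] by linarith
    then show ?thesis
      unfolding cdot_def
      by (intro sum_norm_le) (simp add: norm_mult mult_left_mono)
  qed
  then show ?thesis by (intro bdd_aboveI2) auto
qed

lemma dual_norm_eq_SUP: "dual_norm N w = (SUP z\<in>{z. N z \<le> 1}. cmod (cdot w z))"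
  by (simp add: dual_norm_def cdot_def)

lemma cdot_le_dual_norm: "cmod (cdot w z) \<le> dual_norm N w * N z"
proof (cases "z = 0")
  case True
  then show ?thesis by (simp add: cdot_def N_0)
next
  case False
  then have "0 < N z" by (rule N_pos)
  let ?u = "complex_of_real (1 / N z) *s z"
  have "N ?u = 1" using \<open>0 < N z\<close> by (simp add: N_scale del: of_real_divide)
  then have "cmod (cdot w ?u) \<le> dual_norm N w"
    unfolding dual_norm_eq_SUP by (intro cSUP_upper bdd_above_dual) simp
  then show ?thesis
    using \<open>0 < N z\<close> by (simp add: cdot_scale_right norm_mult norm_divide field_simps)
qed

lemma dual_norm_leI:
  assumes "0 \<le> c" "\<And>z. cmod (cdot w z) \<le> c * N z"
  shows "dual_norm N w \<le> c"
  unfolding dual_norm_eq_SUP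
proof (rule cSUP_least)
  show "{z. N z \<le> 1} \<noteq> {}" using N_0 by (metis (mono_tags) empty_iff mem_Collect_eq zero_le_one)
  show "cmod (cdot w z) \<le> c" if "z \<in> {z. N z \<le> 1}" for z
    using assms(2)[of z] mult_left_mono[of "N z" 1 c] assms(1) that by simp
qed

lemma dual_norm_nonneg: "0 \<le> dual_norm N w"
proof -
  let ?e = "axis undefined 1 :: complex ^ 'n"
  have "0 \<le> dual_norm N w * N ?e"
    using cdot_le_dual_norm[of w ?e] norm_ge_zero order_trans by blast
  moreover have "0 < N ?e" by (rule N_pos) simp
  ultimately show ?thesis by (simp add: zero_le_mult_iff)
qed

lemma dual_norm_eq_0_iff: "dual_norm N w = 0 \<longleftrightarrow> w = 0"
proof
  assume "dual_norm N w = 0"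
  then have "w $ k = 0" for k
    using cdot_le_dual_norm[of w "axis k 1"] by (simp add: cdot_axis)
  then show "w = 0" by (simp add: vec_eq_iff)
next
  assume "w = 0"
  then have "dual_norm N w \<le> 0" by (intro dual_norm_leI) (simp_all add: cdot_def)
  then show "dual_norm N w = 0" using dual_norm_nonneg[of w] by simp
qed

lemma dual_norm_scale_le: "dual_norm N (c *s w) \<le> cmod c * dual_norm N w"
proof (rule dual_norm_leI)
  show "cmod (cdot (c *s w) z) \<le> cmod c * dual_norm N w * N z" for z
    using mult_left_mono[OF cdot_le_dual_norm[of w z], of "cmod c"]
    by (simp add: cdot_scale_left norm_mult mult.assoc)
qed (simp add: dual_norm_nonneg)

lemma dual_norm_triangle: "dual_norm N (v + w) \<le> dual_norm N v + dual_norm N w"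
proof (rule dual_norm_leI)
  show "cmod (cdot (v + w) z) \<le> (dual_norm N v + dual_norm N w) * N z" for z
    using norm_triangle_ineq[of "cdot v z" "cdot w z"] cdot_le_dual_norm[of v z] cdot_le_dual_norm[of w z]
    by (simp add: cdot_add_left distrib_right)
qed (simp add: dual_norm_nonneg)

end

section \<open>The two function spaces and the differential\<close>

lemma module_fun_scale: "module sc \<Longrightarrow> module (fun_scale sc)"
  by (simp add: module_def fun_scale_def fun_eq_iff)

lemma module_mult: "module ((*) :: complex \<Rightarrow> complex \<Rightarrow> complex)"
  and module_vector_scale: "module ((*s) :: complex \<Rightarrow> complex ^ 'n \<Rightarrow> complex ^ 'n)"
  by (auto simp: module_def algebra_simps vec_eq_iff)

context vector_norm
begin

abbreviation B :: "(complex ^ 'n) set" where "B \<equiv> unit_ball N"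

lemma Hinf_s_iff:
  "F \<in> Hinf_s N \<longleftrightarrow> (\<forall>z. z \<notin> B \<longrightarrow> F z = 0) \<and> (\<forall>k. cholomorphic_on (*) (\<lambda>u. F u $ k) B) \<and>
    (\<exists>M. \<forall>z\<in>B. dual_norm N (F z) \<le> M) \<and>
    (\<forall>z\<in>B. \<forall>j k. gradient (\<lambda>u. F u $ j) z $ k = gradient (\<lambda>u. F u $ k) z $ j)"
  by (auto simp: Hinf_s_def Hinf_def cholomorphic_on_vector_iff bdd_above_def cpartial_eq_gradient)

lemma dual_norm_le_Hinf_norm:
  "F \<in> Hinf_s N \<Longrightarrow> z \<in> B \<Longrightarrow> dual_norm N (F z) \<le> Hinf_norm N F"
  unfolding Hinf_norm_def by (rule cSUP_upper) (auto simp: Hinf_s_def Hinf_def)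

lemma Hinf_norm_leI:
  "(\<And>z. z \<in> B \<Longrightarrow> dual_norm N (F z) \<le> c) \<Longrightarrow> Hinf_norm N F \<le> c"
  unfolding Hinf_norm_def using zero_in_unit_ball by (intro cSUP_least) auto

lemma Hinf_norm_nonneg: "F \<in> Hinf_s N \<Longrightarrow> 0 \<le> Hinf_norm N F"
  by (rule order_trans[OF dual_norm_nonneg dual_norm_le_Hinf_norm[OF _ zero_in_unit_ball]])

lemma cnormed_space_Hinf_s: "cnormed_space (fun_scale (*s)) (Hinf_s N) (Hinf_norm N)"
proof (rule cnormed_spaceI)
  show mod: "module (fun_scale (*s) :: complex \<Rightarrow> ((complex ^ 'n) \<Rightarrow> complex ^ 'n) \<Rightarrow> _)"
    by (intro module_fun_scale module_vector_scale)
  show "module.subspace (fun_scale (*s)) (Hinf_s N)"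
  proof (rule module.subspaceI[OF mod])
    have "dual_norm N 0 = 0" by (simp add: dual_norm_eq_0_iff)
    moreover have "gradient (\<lambda>u. 0) z = 0" for z :: "complex ^ 'n"
      using gradient_mult_left(1)[OF cholomorphic_on_zero, of z UNIV 0] by simp
    ultimately show "0 \<in> Hinf_s N"
      by (auto simp: Hinf_s_iff cholomorphic_on_zero intro!: exI[of _ 0])
  next
    fix F G assume FG: "F \<in> Hinf_s N" "G \<in> Hinf_s N"
    have "dual_norm N (F z + G z) \<le> Hinf_norm N F + Hinf_norm N G" if "z \<in> B" for z
      using dual_norm_triangle[of "F z" "G z"] dual_norm_le_Hinf_norm[OF FG(1) that]
        dual_norm_le_Hinf_norm[OF FG(2) that] by linarith
    moreover have "gradient (\<lambda>u. F u $ k + G u $ k) z = gradient (\<lambda>u. F u $ k) z + gradient (\<lambda>u. G u $ k) z"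
      if "z \<in> B" for z k
      using FG that by (intro gradient_add[of _ B]) (auto simp: Hinf_s_iff)
    ultimately show "F + G \<in> Hinf_s N"
      using FG by (auto simp: Hinf_s_iff intro!: cholomorphic_on_add)
  next
    fix c and F assume F: "F \<in> Hinf_s N"
    have "dual_norm N (c *s F z) \<le> cmod c * Hinf_norm N F" if "z \<in> B" for z
      using dual_norm_scale_le[of c "F z"] mult_left_mono[OF dual_norm_le_Hinf_norm[OF F that], of "cmod c"]
      by simp
    moreover have "gradient (\<lambda>u. c * F u $ k) z = c *s gradient (\<lambda>u. F u $ k) z" if "z \<in> B" for z k
      using F that by (intro gradient_mult_left[of _ B]) (auto simp: Hinf_s_iff)
    ultimately show "fun_scale (*s) c F \<in> Hinf_s N"
      using F by (auto simp: Hinf_s_iff fun_scale_def intro!: cholomorphic_on_mult_left)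
  qed
next
  fix F assume F: "F \<in> Hinf_s N"
  show "0 \<le> Hinf_norm N F" by (rule Hinf_norm_nonneg[OF F])
  show "Hinf_norm N F = 0 \<longleftrightarrow> F = 0"
  proof
    assume *: "Hinf_norm N F = 0"
    have "F z = 0" for z
    proof (cases "z \<in> B")
      case True
      then show ?thesis
        using dual_norm_le_Hinf_norm[OF F True] dual_norm_nonneg[of "F z"] dual_norm_eq_0_iff[of "F z"] *
        by simp
    next
      case False
      then show ?thesis using F by (simp add: Hinf_s_iff)
    qed
    then show "F = 0" by (simp add: fun_eq_iff)
  next
    assume "F = 0"
    then have "Hinf_norm N F \<le> 0"
      using dual_norm_eq_0_iff[of 0] by (intro Hinf_norm_leI) simp
    then show "Hinf_norm N F = 0" using Hinf_norm_nonneg[OF F] by simp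
  qed
  show "Hinf_norm N (fun_scale (*s) c F) \<le> cmod c * Hinf_norm N F" for c
  proof (rule Hinf_norm_leI)
    show "dual_norm N (fun_scale (*s) c F z) \<le> cmod c * Hinf_norm N F" if "z \<in> B" for z
      using dual_norm_scale_le[of c "F z"] mult_left_mono[OF dual_norm_le_Hinf_norm[OF F that], of "cmod c"]
      by (simp add: fun_scale_def)
  qed
  show "Hinf_norm N (F + G) \<le> Hinf_norm N F + Hinf_norm N G" if G: "G \<in> Hinf_s N" for G
  proof (rule Hinf_norm_leI)
    show "dual_norm N ((F + G) z) \<le> Hinf_norm N F + Hinf_norm N G" if "z \<in> B" for z
      using dual_norm_triangle[of "F z" "G z"] dual_norm_le_Hinf_norm[OF F that]
        dual_norm_le_Hinf_norm[OF G that] by simp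
  qed
qed

text \<open>
  For each direction \<open>h\<close>, the pairing of the gradient with \<open>h\<close> is the limit of the difference quotients
  \<open>(g(z + t h) - g z) / t\<close>, whose modulus is at most \<open>C * N h\<close> once \<open>z + t h\<close> lies in the ball.
\<close>

lemma dual_norm_gradient_le:
  assumes g: "(g has_derivative cdot (gradient g z)) (at z)" and z: "z \<in> B"
    and lip: "\<And>x y. x \<in> B \<Longrightarrow> y \<in> B \<Longrightarrow> cmod (g x - g y) \<le> C * N (x - y)" and C: "0 \<le> C"
  shows "dual_norm N (gradient g z) \<le> C"
proof (rule dual_norm_leI[OF C])
  fix h
  have "((\<lambda>t. g (z + t *s h)) has_field_derivative cdot (gradient g z) h) (at 0)"
    using has_field_derivative_along_line[of g "gradient g z" z 0 h] g by simp
  then have lim: "((\<lambda>t. cmod ((g (z + t *s h) - g z) / t)) \<longlongrightarrow> cmod (cdot (gradient g z) h)) (at 0)"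
    by (auto simp: DERIV_def intro: tendsto_norm)
  have "((\<lambda>t. z + t *s h) \<longlongrightarrow> z + 0 *s h) (at (0::complex))"
    by (intro tendsto_add tendsto_const bounded_linear.tendsto[OF bounded_linear_vector_scale] tendsto_ident_at)
  then have "eventually (\<lambda>t. z + t *s h \<in> B) (at 0)"
    using z by (intro topological_tendstoD[OF _ open_unit_ball]) auto
  moreover have "eventually (\<lambda>t::complex. t \<noteq> 0) (at 0)"
    by (rule eventually_neq_at_within)
  ultimately have "eventually (\<lambda>t. cmod ((g (z + t *s h) - g z) / t) \<le> C * N h) (at 0)"
  proof eventually_elim
    case (elim t)
    have "cmod (g (z + t *s h) - g z) \<le> C * N (z + t *s h - z)"
      using elim z by (intro lip)
    also have "N (z + t *s h - z) = cmod t * N h"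
      by (simp add: N_scale)
    finally show ?case
      using elim by (simp add: norm_divide field_simps)
  qed
  with lim show "cmod (cdot (gradient g z) h) \<le> C * N h"
    by (rule tendsto_upperbound) simp
qed

text \<open>
  The mean value inequality on the segment from \<open>y\<close> to \<open>x\<close>, which lies in the ball by convexity: the
  derivative of \<open>g\<close> along it is \<open>cdot (F _) (x - y)\<close>.
\<close>

lemma lipschitz_of_dual_norm_le:
  assumes g: "\<And>z. z \<in> B \<Longrightarrow> (g has_derivative cdot (F z)) (at z)"
    and M: "\<And>z. z \<in> B \<Longrightarrow> dual_norm N (F z) \<le> M"
    and x: "x \<in> B" and y: "y \<in> B"
  shows "cmod (g x - g y) \<le> M * N (x - y)"
proof -
  have seg: "y + t *s (x - y) \<in> B" if t: "t \<in> closed_segment (0::complex) 1" for t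
  proof -
    obtain u where u: "0 \<le> u" "u \<le> 1" "t = of_real u"
      using t by (auto simp: in_segment scaleR_conv_of_real)
    have "y + t *s (x - y) = (1 - u) *\<^sub>R y + u *\<^sub>R x"
      by (simp add: u vec_eq_iff scaleR_conv_of_real[where 'a = complex] algebra_simps)
    also have "\<dots> \<in> B"
      using u x y by (intro convexD[OF convex_unit_ball]) auto
    finally show ?thesis .
  qed
  have "cmod (g (y + 1 *s (x - y)) - g (y + 0 *s (x - y))) \<le> (M * N (x - y)) * cmod (1 - 0)"
  proof (rule field_differentiable_bound[of "closed_segment 0 1" "\<lambda>t. g (y + t *s (x - y))"])
    fix t :: complex assume t: "t \<in> closed_segment 0 1"
    show "((\<lambda>t. g (y + t *s (x - y))) has_field_derivative cdot (F (y + t *s (x - y))) (x - y))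
        (at t within closed_segment 0 1)"
      by (rule has_field_derivative_at_within, rule has_field_derivative_along_line, rule g, rule seg, rule t)
    show "cmod (cdot (F (y + t *s (x - y))) (x - y)) \<le> M * N (x - y)"
      using cdot_le_dual_norm[of "F (y + t *s (x - y))" "x - y"]
        mult_right_mono[OF M[OF seg[OF t]] N_nonneg[of "x - y"]] by linarith
  qed auto
  then show ?thesis by simp
qed

lemma HL0_D:
  assumes "g \<in> HL0 N"
  shows "cholomorphic_on (*) g B" "z \<notin> B \<Longrightarrow> g z = 0" "g 0 = 0"
    "\<exists>C. \<forall>x\<in>B. \<forall>y\<in>B. cmod (g x - g y) \<le> C * N (x - y)"
  using assms by (auto simp: HL0_def)

lemma lipschitz_lip_norm:
  assumes g: "g \<in> HL0 N" and x: "x \<in> B" and y: "y \<in> B"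
  shows "cmod (g x - g y) \<le> lip_norm N g * N (x - y)"
proof (cases "x = y")
  case False
  obtain C where C: "\<forall>x\<in>B. \<forall>y\<in>B. cmod (g x - g y) \<le> C * N (x - y)"
    using HL0_D(4)[OF g] by blast
  have "bdd_above {cmod (g x - g y) / N (x - y) |x y. x \<in> B \<and> y \<in> B \<and> x \<noteq> y}"
    using C by (intro bdd_aboveI[of _ C]) (auto simp: divide_le_eq N_pos)
  then have "cmod (g x - g y) / N (x - y) \<le> lip_norm N g"
    unfolding lip_norm_def using x y False by (intro cSup_upper) auto
  then show ?thesis using N_pos[of "x - y"] False by (simp add: divide_le_eq)
qed (simp add: N_0)

text \<open>
  The supremum that defines \<open>lip_norm\<close> runs over pairs of distinct points of the ball, so it is
  meaningful only because there are such pairs.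
\<close>

lemma nonzero_in_unit_ball:
  obtains e where "e \<in> B" "e \<noteq> 0"
proof -
  define e where "e = (axis undefined 1 :: complex ^ 'n)"
  have e: "0 < N e" by (intro N_pos) (simp add: e_def)
  define w where "w = complex_of_real (1 / (2 * N e)) *s e"
  have "N w = 1 / 2"
    using e by (simp add: w_def N_scale norm_divide norm_mult)
  then have "w \<in> B" and "N w \<noteq> 0" by (simp_all add: unit_ball_def)
  then show ?thesis using that[of w] N_0 by metis
qed

lemma lip_norm_leI:
  assumes "\<And>x y. x \<in> B \<Longrightarrow> y \<in> B \<Longrightarrow> cmod (g x - g y) \<le> c * N (x - y)"
  shows "lip_norm N g \<le> c"
  unfolding lip_norm_def
proof (rule cSup_least)
  obtain e where "e \<in> B" "e \<noteq> 0" by (rule nonzero_in_unit_ball)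
  then show "{cmod (g x - g y) / N (x - y) |x y. x \<in> B \<and> y \<in> B \<and> x \<noteq> y} \<noteq> {}"
    using zero_in_unit_ball by auto
qed (use assms in \<open>auto simp: divide_le_eq N_pos\<close>)

lemma lip_norm_nonneg:
  assumes "g \<in> HL0 N"
  shows "0 \<le> lip_norm N g"
proof -
  obtain e where e: "e \<in> B" "e \<noteq> 0" by (rule nonzero_in_unit_ball)
  have "0 \<le> lip_norm N g * N (e - 0)"
    by (rule order_trans[OF norm_ge_zero lipschitz_lip_norm[OF assms e(1) zero_in_unit_ball]])
  then show ?thesis using N_pos[OF e(2)] by (simp add: zero_le_mult_iff)
qed

lemma differential_eq: "differential N g = (\<lambda>z. if z \<in> B then gradient g z else 0)"
  unfolding differential_def gradient_def ..

lemma HL0_has_derivative: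
  "g \<in> HL0 N \<Longrightarrow> z \<in> B \<Longrightarrow> (g has_derivative cdot (gradient g z)) (at z)"
  using HL0_D(1) cholomorphic_on_scalar_iff by blast

lemma gradient_cong_unit_ball:
  assumes "cholomorphic_on (*) f B" "z \<in> B" "\<And>u. u \<in> B \<Longrightarrow> f u = g u"
  shows "(g has_derivative cdot (gradient f z)) (at z)" "gradient g z = gradient f z"
proof -
  have "(f has_derivative cdot (gradient f z)) (at z)"
    using assms by (simp add: cholomorphic_on_scalar_iff)
  then show "(g has_derivative cdot (gradient f z)) (at z)"
    by (rule has_derivative_transform_within_open[OF _ open_unit_ball assms(2,3)])
  then show "gradient g z = gradient f z" by (rule gradient_unique)
qed

lemma dual_norm_gradient_le_lip_norm:
  assumes g: "g \<in> HL0 N" and z: "z \<in> B"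
  shows "dual_norm N (gradient g z) \<le> lip_norm N g"
proof (rule dual_norm_gradient_le[where g = g])
  show "(g has_derivative cdot (gradient g z)) (at z)" by (rule HL0_has_derivative[OF g z])
  show "cmod (g x - g y) \<le> lip_norm N g * N (x - y)" if "x \<in> B" "y \<in> B" for x y
    by (rule lipschitz_lip_norm[OF g that])
qed (rule z lip_norm_nonneg[OF g])+

lemma differential_in_Hinf_s:
  assumes g: "g \<in> HL0 N"
  shows "differential N g \<in> Hinf_s N"
proof -
  have holo: "cholomorphic_on (*) (cpartial k g) B" for k
    by (rule cholomorphic_on_cpartial[OF open_unit_ball HL0_D(1)[OF g]])
  have eq: "cpartial k g u = differential N g u $ k" if "u \<in> B" for k u
    using that by (simp add: differential_eq gradient_def)
  \<comment> \<open>The ball is open, so equality there carries over to derivatives.\<close>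
  have d: "((\<lambda>u. differential N g u $ k) has_derivative cdot (gradient (cpartial k g) z)) (at z)"
    if "z \<in> B" for k z
    by (rule gradient_cong_unit_ball[OF holo that eq])
  show ?thesis
    unfolding Hinf_s_iff
  proof (intro conjI allI ballI impI exI)
    show "differential N g z = 0" if "z \<notin> B" for z
      using that by (simp add: differential_eq)
    show "cholomorphic_on (*) (\<lambda>u. differential N g u $ k) B" for k
      by (rule cholomorphic_on_scalarI) (rule d)
    show "dual_norm N (differential N g z) \<le> lip_norm N g" if "z \<in> B" for z
      using dual_norm_gradient_le_lip_norm[OF g that] that by (simp add: differential_eq)
    show "gradient (\<lambda>u. differential N g u $ j) z $ k = gradient (\<lambda>u. differential N g u $ k) z $ j"
      if z: "z \<in> B" for z j k
      unfolding gradient_unique[OF d[OF z]] cpartial_eq_gradient[symmetric]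
      by (rule cpartial_commute[OF open_unit_ball HL0_D(1)[OF g] z])
  qed
qed

lemma Hinf_norm_differential:
  assumes g: "g \<in> HL0 N"
  shows "Hinf_norm N (differential N g) = lip_norm N g"
proof (rule antisym)
  show "Hinf_norm N (differential N g) \<le> lip_norm N g"
    by (rule Hinf_norm_leI) (simp add: differential_eq dual_norm_gradient_le_lip_norm[OF g])
  have bound: "dual_norm N (gradient g z) \<le> Hinf_norm N (differential N g)" if "z \<in> B" for z
    using dual_norm_le_Hinf_norm[OF differential_in_Hinf_s[OF g] that] that by (simp add: differential_eq)
  show "lip_norm N g \<le> Hinf_norm N (differential N g)"
  proof (rule lip_norm_leI)
    fix x y assume xy: "x \<in> B" "y \<in> B"
    show "cmod (g x - g y) \<le> Hinf_norm N (differential N g) * N (x - y)"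
    proof (rule lipschitz_of_dual_norm_le[where g = g and F = "gradient g"])
      show "(g has_derivative cdot (gradient g z)) (at z)" if "z \<in> B" for z
        by (rule HL0_has_derivative[OF g that])
      show "dual_norm N (gradient g z) \<le> Hinf_norm N (differential N g)" if "z \<in> B" for z
        by (rule bound[OF that])
    qed (rule xy)+
  qed
qed

lemma differential_add:
  assumes "f \<in> HL0 N" "g \<in> HL0 N"
  shows "differential N (f + g) = differential N f + differential N g"
  using gradient_add(1)[OF HL0_D(1)[OF assms(1)] HL0_D(1)[OF assms(2)]]
  by (auto simp: fun_eq_iff differential_eq plus_fun_def)

lemma differential_scale:
  assumes "g \<in> HL0 N"
  shows "differential N (fun_scale (*) c g) = fun_scale (*s) c (differential N g)"
  using gradient_mult_left(1)[OF HL0_D(1)[OF assms], of _ c]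
  by (auto simp: fun_eq_iff differential_eq fun_scale_def)

text \<open>
  Boundedness on the ball follows from the Lipschitz bound, comparing with the value at \<open>0\<close>.
\<close>

lemma HL0_I:
  assumes "\<And>z. z \<notin> B \<Longrightarrow> g z = 0" "cholomorphic_on (*) g B" "g 0 = 0"
    and lip: "\<And>x y. x \<in> B \<Longrightarrow> y \<in> B \<Longrightarrow> cmod (g x - g y) \<le> C * N (x - y)"
  shows "g \<in> HL0 N"
proof -
  have "cmod (g x) \<le> \<bar>C\<bar>" if "x \<in> B" for x
  proof -
    have "cmod (g x) \<le> C * N x"
      using lip[OF that zero_in_unit_ball] assms(3) by simp
    also have "\<dots> \<le> \<bar>C\<bar> * 1"
      using that N_nonneg[of x] by (intro mult_mono) (auto simp: unit_ball_def)
    finally show ?thesis by simp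
  qed
  then have "bounded (g ` B)" by (auto simp: bounded_iff)
  then show ?thesis using assms by (auto simp: HL0_def)
qed

lemma cnormed_space_HL0: "cnormed_space (fun_scale (*)) (HL0 N) (lip_norm N)"
proof (rule cnormed_spaceI)
  show mod: "module (fun_scale (*) :: complex \<Rightarrow> ((complex ^ 'n) \<Rightarrow> complex) \<Rightarrow> _)"
    by (intro module_fun_scale module_mult)
  have add: "cmod ((f + g) x - (f + g) y) \<le> (lip_norm N f + lip_norm N g) * N (x - y)"
    if "f \<in> HL0 N" "g \<in> HL0 N" "x \<in> B" "y \<in> B" for f g x y
  proof -
    have "cmod ((f + g) x - (f + g) y) \<le> cmod (f x - f y) + cmod (g x - g y)"
      using norm_triangle_ineq[of "f x - f y" "g x - g y"] by (simp add: algebra_simps)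
    then show ?thesis
      using lipschitz_lip_norm[OF that(1,3,4)] lipschitz_lip_norm[OF that(2,3,4)]
      by (simp add: distrib_right)
  qed
  have scale: "cmod (fun_scale (*) c g x - fun_scale (*) c g y) \<le> (cmod c * lip_norm N g) * N (x - y)"
    if "g \<in> HL0 N" "x \<in> B" "y \<in> B" for c g x y
    using mult_left_mono[OF lipschitz_lip_norm[OF that], of "cmod c"]
    by (simp add: fun_scale_def norm_mult mult.assoc flip: right_diff_distrib)
  show "module.subspace (fun_scale (*)) (HL0 N)"
  proof (rule module.subspaceI[OF mod])
    show "0 \<in> HL0 N"
      by (rule HL0_I[where C = 0]) (simp_all add: zero_fun_def cholomorphic_on_zero)
  next
    fix f g assume fg: "f \<in> HL0 N" "g \<in> HL0 N"
    show "f + g \<in> HL0 N"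
      using fg by (intro HL0_I[OF _ _ _ add[OF fg]])
        (auto simp: HL0_D plus_fun_def intro!: cholomorphic_on_add)
  next
    fix c g assume g: "g \<in> HL0 N"
    show "fun_scale (*) c g \<in> HL0 N"
      using g by (intro HL0_I[OF _ _ _ scale[OF g]])
        (auto simp: HL0_D fun_scale_def intro!: cholomorphic_on_mult_left)
  qed
  fix g assume g: "g \<in> HL0 N"
  show "0 \<le> lip_norm N g" by (rule lip_norm_nonneg[OF g])
  show "lip_norm N g = 0 \<longleftrightarrow> g = 0"
  proof
    assume *: "lip_norm N g = 0"
    have "g z = 0" for z
    proof (cases "z \<in> B")
      case True
      then show ?thesis
        using lipschitz_lip_norm[OF g True zero_in_unit_ball] HL0_D(3)[OF g] * by simp
    next
      case False
      then show ?thesis using HL0_D(2)[OF g] by simp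
    qed
    then show "g = 0" by (simp add: fun_eq_iff)
  next
    assume "g = 0"
    then have "lip_norm N g \<le> 0" by (intro lip_norm_leI) simp
    then show "lip_norm N g = 0" using lip_norm_nonneg[OF g] by simp
  qed
  show "lip_norm N (fun_scale (*) c g) \<le> cmod c * lip_norm N g" for c
    by (rule lip_norm_leI) (rule scale[OF g])
  show "lip_norm N (g + h) \<le> lip_norm N g + lip_norm N h" if "h \<in> HL0 N" for h
    by (rule lip_norm_leI) (rule add[OF g that])
qed

text \<open>
  A primitive of \<open>F\<close> that vanishes at \<open>0\<close> is Lipschitz because the dual norms of its gradients
  are bounded.
\<close>

lemma differential_surj:
  assumes F: "F \<in> Hinf_s N"
  shows "F \<in> differential N ` HL0 N"
proof -
  have "cholomorphic_on (*s) F B"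
    and "\<And>z j k. z \<in> B \<Longrightarrow> cpartial k (\<lambda>u. F u $ j) z = cpartial j (\<lambda>u. F u $ k) z"
    using F by (auto simp: Hinf_s_def Hinf_def)
  then obtain g0 where g0: "g0 0 = 0" "\<And>z. z \<in> B \<Longrightarrow> (g0 has_derivative cdot (F z)) (at z)"
    using closed_form_has_primitive[OF open_unit_ball convex_unit_ball zero_in_unit_ball] by blast
  define g where "g z = (if z \<in> B then g0 z else 0)" for z
  have dg: "(g has_derivative cdot (F z)) (at z)" if "z \<in> B" for z
    by (rule has_derivative_transform_within_open[OF g0(2)[OF that] open_unit_ball that])
      (simp add: g_def)
  have g: "g \<in> HL0 N"
  proof (rule HL0_I)
    show "cholomorphic_on (*) g B" by (rule cholomorphic_on_scalarI) (rule dg)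
    show "cmod (g x - g y) \<le> Hinf_norm N F * N (x - y)" if xy: "x \<in> B" "y \<in> B" for x y
    proof (rule lipschitz_of_dual_norm_le[where g = g and F = F])
      show "(g has_derivative cdot (F z)) (at z)" if "z \<in> B" for z
        by (rule dg[OF that])
      show "dual_norm N (F z) \<le> Hinf_norm N F" if "z \<in> B" for z
        by (rule dual_norm_le_Hinf_norm[OF F that])
    qed (rule xy)+
  qed (auto simp: g_def g0)
  have "differential N g = F"
  proof
    fix z
    show "differential N g z = F z"
    proof (cases "z \<in> B")
      case True
      then show ?thesis by (simp add: differential_eq gradient_unique[OF dg])
    next
      case False
      then show ?thesis using F by (simp add: differential_eq Hinf_s_iff)
    qed
  qed
  then show ?thesis by (rule image_eqI[OF sym g])
qed

end

theorem corollary2p3: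
  fixes N :: "complex ^ 'n \<Rightarrow> real"
  assumes "cnormed_space (*s) UNIV N"
  shows "isometric_isomorphism
           (fun_scale (*)) (HL0 N) (lip_norm N)
           (fun_scale (*s)) (Hinf_s N) (Hinf_norm N)
           (differential N)"
proof -
  interpret vector_norm N by unfold_locales fact
  show ?thesis
    unfolding isometric_isomorphism_def
    by (intro conjI ballI allI cnormed_space_HL0 cnormed_space_Hinf_s differential_add
        differential_scale Hinf_norm_differential equalityI image_subsetI subsetI
        differential_in_Hinf_s differential_surj)
qed

end
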